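(* Let $\mathbb{B}_0=(\sigma_x,\sigma_y,\sigma_z)$ be the basis of the Lie algebra $\mathfrak{su}(2)$ of $\mathrm{SU}(2)$ with $[\sigma_x,\sigma_y]=2\sigma_z$, $[\sigma_y,\sigma_z]=2\sigma_x$, $[\sigma_z,\sigma_x]=2\sigma_y$. Then any Lorentzian left invariant metric on $\mathrm{SU}(2)$ is isometric, via an automorphism of $\mathrm{SU}(2)$, to a left invariant metric whose matrix in $\mathbb{B}_0$ is $$\begin{pmatrix}\mu_1&0&0\\0&\mu_2&0\\0&0&-\mu_3\end{pmatrix}\quad\text{for some real numbers } \mu_1\ge\mu_2>0,\ \mu_3>0.$$
   Context: A Lorentzian left invariant metric $h$ on a three dimensional Lie group $G$ is identified with a nondegenerate symmetric bilinear form of signature $(+,+,-)$ on the Lie algebra $\mathfrak{g}$; its matrix in a basis $\mathbb{B}_0$ is the Gram matrix of this form. Two left invariant metrics $h_1,h_2$ on $G$ are isometric via an automorphism if there is a Lie group automorphism $\phi$ of $G$ with $h_1=\phi^*h_2$; since $G$ is simply connected, this is equivalent to the existence of a Lie algebra automorphism of $\mathfrak{g}$ pulling back one form to the other. *)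

theory Defs
  imports "HOL-Analysis.Analysis"
begin

type_synonym cmat2 = "complex ^ 2 ^ 2"

section \<open>Smooth maps on subsets of a Euclidean space\<close>

text \<open>The C-k condition on an open set, through iterated directional derivatives.\<close>

primrec Ck_on :: "nat \<Rightarrow> 'a::euclidean_space set \<Rightarrow> ('a \<Rightarrow> 'b::euclidean_space) \<Rightarrow> bool" where
  "Ck_on 0 U f \<longleftrightarrow> continuous_on U f"
| "Ck_on (Suc k) U f \<longleftrightarrow>
     (\<forall>x\<in>U. f differentiable (at x)) \<and>
     (\<forall>v. Ck_on k U (\<lambda>x. frechet_derivative f (at x) v))"

text \<open>A map on an embedded submanifold is smooth iff it extends, locally around every
  point, to a smooth map on an open set of the ambient space.\<close>

definition smooth_map_on ::
    "'a::euclidean_space set \<Rightarrow> ('a \<Rightarrow> 'b::euclidean_space) \<Rightarrow> bool" where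
  "smooth_map_on S f \<longleftrightarrow>
     (\<forall>x\<in>S. \<exists>U F. open U \<and> x \<in> U \<and> (\<forall>k. Ck_on k U F) \<and> (\<forall>y\<in>S \<inter> U. F y = f y))"

definition tangent_space :: "'a::euclidean_space set \<Rightarrow> 'a \<Rightarrow> 'a set" where
  "tangent_space S x =
     {v. \<exists>\<gamma>::real \<Rightarrow> 'a. (\<forall>t. \<gamma> t \<in> S) \<and> \<gamma> 0 = x \<and> (\<gamma> has_vector_derivative v) (at 0)}"

section \<open>The Lie group SU(2) and its Lie algebra\<close>

definition adj :: "cmat2 \<Rightarrow> cmat2" where
  "adj A = (\<chi> i j. cnj (A $ j $ i))"

definition SU2 :: "cmat2 set" where
  "SU2 = {A. adj A ** A = mat 1 \<and> det A = 1}"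

definition su2 :: "cmat2 set" where
  "su2 = {X. adj X = - X \<and> trace X = 0}"

definition lie_bracket :: "cmat2 \<Rightarrow> cmat2 \<Rightarrow> cmat2" where
  "lie_bracket X Y = X ** Y - Y ** X"

definition SU2_automorphism :: "(cmat2 \<Rightarrow> cmat2) \<Rightarrow> bool" where
  "SU2_automorphism \<phi> \<longleftrightarrow>
     bij_betw \<phi> SU2 SU2 \<and>
     (\<forall>a\<in>SU2. \<forall>b\<in>SU2. \<phi> (a ** b) = \<phi> a ** \<phi> b) \<and>
     smooth_map_on SU2 \<phi> \<and>
     smooth_map_on SU2 (inv_into SU2 \<phi>)"

section \<open>Lorentzian forms\<close>

definition ordered_basis :: "'a::real_vector set \<Rightarrow> 'a list \<Rightarrow> bool" where
  "ordered_basis V bs \<longleftrightarrow> distinct bs \<and> independent (set bs) \<and> span (set bs) = V"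

definition symmetric_bilinear_on ::
    "'a::real_vector set \<Rightarrow> ('a \<Rightarrow> 'a \<Rightarrow> real) \<Rightarrow> bool" where
  "symmetric_bilinear_on V q \<longleftrightarrow>
     (\<forall>x\<in>V. \<forall>y\<in>V. q x y = q y x) \<and>
     (\<forall>x\<in>V. \<forall>y\<in>V. \<forall>z\<in>V. q (x + y) z = q x z + q y z) \<and>
     (\<forall>c. \<forall>x\<in>V. \<forall>y\<in>V. q (c *\<^sub>R x) y = c * q x y)"

definition nondegenerate_on ::
    "'a::real_vector set \<Rightarrow> ('a \<Rightarrow> 'a \<Rightarrow> real) \<Rightarrow> bool" where
  "nondegenerate_on V q \<longleftrightarrow> (\<forall>x\<in>V. (\<forall>y\<in>V. q x y = 0) \<longrightarrow> x = 0)"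

text \<open>Signature (+,+,-), read off from a diagonalising basis; by Sylvester's law of
  inertia the signs do not depend on the basis.\<close>

definition signature_ppm_on ::
    "'a::real_vector set \<Rightarrow> ('a \<Rightarrow> 'a \<Rightarrow> real) \<Rightarrow> bool" where
  "signature_ppm_on V q \<longleftrightarrow>
     (\<exists>e\<^sub>1 e\<^sub>2 e\<^sub>3. ordered_basis V [e\<^sub>1, e\<^sub>2, e\<^sub>3] \<and>
        q e\<^sub>1 e\<^sub>2 = 0 \<and> q e\<^sub>1 e\<^sub>3 = 0 \<and> q e\<^sub>2 e\<^sub>3 = 0 \<and>
        q e\<^sub>1 e\<^sub>1 > 0 \<and> q e\<^sub>2 e\<^sub>2 > 0 \<and> q e\<^sub>3 e\<^sub>3 < 0)"

definition lorentzian_form_on ::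
    "'a::real_vector set \<Rightarrow> ('a \<Rightarrow> 'a \<Rightarrow> real) \<Rightarrow> bool" where
  "lorentzian_form_on V q \<longleftrightarrow>
     symmetric_bilinear_on V q \<and> nondegenerate_on V q \<and> signature_ppm_on V q"

definition gram_matrix ::
    "('a \<Rightarrow> 'a \<Rightarrow> real) \<Rightarrow> 'a ^ 'n \<Rightarrow> real ^ 'n ^ 'n" where
  "gram_matrix q B = (\<chi> i j. q (B $ i) (B $ j))"

section \<open>Left invariant metrics and isometry via an automorphism\<close>

text \<open>The left invariant metric on SU(2), as a field of forms on the tangent spaces, that is
  determined by a form \<open>q\<close> on the Lie algebra.\<close>

definition left_invariant_metric ::
    "(cmat2 \<Rightarrow> cmat2 \<Rightarrow> real) \<Rightarrow> cmat2 \<Rightarrow> cmat2 \<Rightarrow> cmat2 \<Rightarrow> real" where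
  "left_invariant_metric q g X Y = q (matrix_inv g ** X) (matrix_inv g ** Y)"

text \<open>The derivative within SU(2) depends only on the values of \<open>\<phi>\<close> on SU(2). It is
  uniquely determined only on vectors tangent to SU(2), so the pull-back is meaningful
  only for such arguments.\<close>

definition pullback_metric ::
    "(cmat2 \<Rightarrow> cmat2) \<Rightarrow> (cmat2 \<Rightarrow> cmat2 \<Rightarrow> cmat2 \<Rightarrow> real) \<Rightarrow>
      cmat2 \<Rightarrow> cmat2 \<Rightarrow> cmat2 \<Rightarrow> real" where
  "pullback_metric \<phi> h g X Y =
     h (\<phi> g) (frechet_derivative \<phi> (at g within SU2) X)
             (frechet_derivative \<phi> (at g within SU2) Y)"

definition isometric_via_automorphism ::
    "(cmat2 \<Rightarrow> cmat2 \<Rightarrow> cmat2 \<Rightarrow> real) \<Rightarrow> (cmat2 \<Rightarrow> cmat2 \<Rightarrow> cmat2 \<Rightarrow> real) \<Rightarrow> bool" where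
  "isometric_via_automorphism h\<^sub>1 h\<^sub>2 \<longleftrightarrow>
     (\<exists>\<phi>. SU2_automorphism \<phi> \<and>
        (\<forall>g\<in>SU2. \<forall>X\<in>tangent_space SU2 g. \<forall>Y\<in>tangent_space SU2 g.
           h\<^sub>1 g X Y = pullback_metric \<phi> h\<^sub>2 g X Y))"

end

theory Submission
  imports Defs
begin

text \<open>The isometry is a conjugation. Choose \<open>P\<close> in the compact group \<open>SU2\<close> minimising
  \<open>q z z - q x x\<close>, where \<open>x\<close>, \<open>y\<close>, \<open>z\<close> are the conjugates of the basis by \<open>P\<close>. The three
  one-parameter rotation groups about \<open>x\<close>, \<open>y\<close>, \<open>z\<close> are implemented by conjugations with
  \<open>c + s x\<close>, \<open>c + s y\<close>, \<open>c + s z\<close>, so criticality of \<open>P\<close> forces the off-diagonal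
  Gram entries to vanish, and minimality orders the diagonal ones. The signature then
  determines their signs. This avoids both the spectral theorem and the
  surjectivity of \<open>SU(2) \<rightarrow> SO(3)\<close>.\<close>

section \<open>Matrix algebra\<close>

lemma matrix_sub_ldistrib': "A ** (B - C) = A ** B - A ** (C :: 'a::ring_1 ^ 'n ^ 'm)"
  by (vector matrix_matrix_mult_def sum_subtractf[symmetric] right_diff_distrib)

lemma matrix_sub_rdistrib': "(A - B) ** C = A ** C - B ** (C :: 'a::ring_1 ^ 'n ^ 'm)"
  by (vector matrix_matrix_mult_def sum_subtractf[symmetric] left_diff_distrib)

lemma matrix_add_rdistrib': "(A + B) ** C = A ** C + B ** (C :: 'a::semiring_1 ^ 'n ^ 'm)"
  by (vector matrix_matrix_mult_def sum.distrib[symmetric] distrib_right)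

lemmas matrix_distribs = matrix_add_ldistrib matrix_add_rdistrib'
  matrix_sub_ldistrib' matrix_sub_rdistrib' scalar_matrix_assoc[symmetric] matrix_scalar_ac

lemma matrix_minus_left: "(- A) ** B = - (A ** (B :: 'a::ring_1 ^ 'n ^ 'm))"
  by (vector matrix_matrix_mult_def sum_negf[symmetric])

lemma matrix_minus_right: "A ** (- B) = - (A ** (B :: 'a::ring_1 ^ 'n ^ 'm))"
  by (vector matrix_matrix_mult_def sum_negf[symmetric])

lemma cmat2_eq_iff:
  "A = (B :: cmat2) \<longleftrightarrow> A$1$1 = B$1$1 \<and> A$1$2 = B$1$2 \<and> A$2$1 = B$2$1 \<and> A$2$2 = B$2$2"
  by (auto simp: vec_eq_iff forall_2)

lemma matrix_mult_2: "(A ** B) $ i $ j = A$i$1 * B$1$j + A$i$2 * (B :: cmat2)$2$j"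
  by (simp add: matrix_matrix_mult_def sum_2)

lemma matrix_inv_eqI:
  fixes A :: "'a::field ^ 'n ^ 'n"
  assumes "A ** B = mat 1"
  shows "matrix_inv A = B"
proof -
  have "B ** A = mat 1" using assms matrix_left_right_inverse by blast
  then have "\<exists>A'. A ** A' = mat 1 \<and> A' ** A = mat 1" using assms by blast
  then have "matrix_inv A ** A = mat 1" unfolding matrix_inv_def by (rule someI2_ex) simp
  then show ?thesis by (metis assms matrix_mul_assoc matrix_mul_lid matrix_mul_rid)
qed

section \<open>The conjugate transpose and the group structure of \<open>SU2\<close>\<close>

lemma adj_nth [simp]: "adj A $ i $ j = cnj (A $ j $ i)"
  by (simp add: adj_def)

lemma adj_adj [simp]: "adj (adj A) = A"
  by (simp add: vec_eq_iff)

lemma adj_add: "adj (A + B) = adj A + adj B"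
  by (simp add: vec_eq_iff)

lemma adj_scaleR: "adj (c *\<^sub>R A) = c *\<^sub>R adj A"
  by (simp add: vec_eq_iff)

lemma adj_mat_1: "adj (mat 1) = mat 1"
  by (simp add: vec_eq_iff mat_def)

lemma adj_mult: "adj (A ** B) = adj B ** adj A"
  by (simp add: cmat2_eq_iff matrix_mult_2 mult.commute)

lemma det_adj: "det (adj A) = cnj (det A)"
  by (simp add: det_2 mult.commute)

lemma SU2_adj_right: "P \<in> SU2 \<Longrightarrow> P ** adj P = mat 1"
  unfolding SU2_def using matrix_left_right_inverse by blast

lemma SU2_adj_left: "P \<in> SU2 \<Longrightarrow> adj P ** P = mat 1"
  by (simp add: SU2_def)

lemma SU2_adj: "P \<in> SU2 \<Longrightarrow> adj P \<in> SU2"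
  using SU2_adj_right[of P] by (simp add: SU2_def det_adj)

lemma SU2_mult:
  assumes "P \<in> SU2" "Q \<in> SU2" shows "P ** Q \<in> SU2"
proof -
  have "adj (P ** Q) ** (P ** Q) = adj Q ** (adj P ** P) ** Q"
    by (simp add: adj_mult matrix_mul_assoc)
  then show ?thesis using assms by (simp add: SU2_def det_mul)
qed

lemma SU2_matrix_inv: "P \<in> SU2 \<Longrightarrow> matrix_inv P = adj P"
  by (intro matrix_inv_eqI SU2_adj_right)

text \<open>The columns of a unitary matrix are unit vectors, which bounds all entries, and the
  defining equations are polynomial in the entries and their conjugates. Compactness supplies the
  minimiser from which the diagonalisation starts.\<close>

lemma compact_SU2: "compact SU2"
proof -
  have "norm A \<le> 4" if "A \<in> SU2" for A
  proof -
    have *: "cmod (A $ i $ j) \<le> 1" for i j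
    proof -
      have "(adj A ** A) $ j $ j = 1" using that by (simp add: SU2_def mat_def)
      then have "complex_of_real ((cmod (A$1$j))\<^sup>2 + (cmod (A$2$j))\<^sup>2) = 1"
        by (simp only: matrix_mult_2 adj_nth of_real_add complex_norm_square mult.commute)
      then have e: "(cmod (A$1$j))\<^sup>2 + (cmod (A$2$j))\<^sup>2 = 1"
        by (simp only: of_real_eq_1_iff)
      have "(cmod (A$i$j))\<^sup>2 \<le> 1"
        using e exhaust_2[of i] zero_le_power2[of "cmod (A$1$j)"] zero_le_power2[of "cmod (A$2$j)"]
        by (smt (verit))
      then show ?thesis by (simp add: abs_square_le_1)
    qed
    have "norm (A $ i) \<le> cmod (A$i$1) + cmod (A$i$2)" for i
      using L2_set_le_sum[of UNIV "\<lambda>j. cmod (A$i$j)"] by (simp add: norm_vec_def sum_2)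
    moreover have "norm A \<le> norm (A$1) + norm (A$2)"
      using L2_set_le_sum[of UNIV "\<lambda>j. norm (A$j)"] by (simp add: norm_vec_def sum_2)
    ultimately show ?thesis using *[of 1 1] *[of 1 2] *[of 2 1] *[of 2 2]
      by (smt (verit))
  qed
  then have "bounded SU2" by (auto simp: bounded_iff)
  moreover have "closed SU2"
    unfolding SU2_def det_2 cmat2_eq_iff matrix_mult_2 adj_nth
    by (intro closed_Collect_conj closed_Collect_eq continuous_intros)
  ultimately show ?thesis by (simp add: compact_eq_bounded_closed)
qed

section \<open>Conjugation by elements of \<open>SU(2)\<close>\<close>

text \<open>With \<open>adj P\<close> in place of an inverse the map is linear for every
  \<open>P\<close>, and its entries are visibly continuous in \<open>P\<close>.\<close>

definition conj_by :: "cmat2 \<Rightarrow> cmat2 \<Rightarrow> cmat2" where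
  "conj_by P A = P ** A ** adj P"

lemma linear_conj_by: "linear (conj_by P)"
  by (rule linearI) (simp_all add: conj_by_def matrix_distribs)

lemma conj_by_mult:
  assumes "P \<in> SU2" shows "conj_by P (A ** B) = conj_by P A ** conj_by P B"
proof -
  have "conj_by P A ** conj_by P B = P ** A ** (adj P ** P) ** B ** adj P"
    by (simp add: conj_by_def matrix_mul_assoc)
  then show ?thesis using SU2_adj_left[OF assms] by (simp add: conj_by_def matrix_mul_assoc)
qed

lemma conj_by_conj_by: "conj_by P (conj_by Q A) = conj_by (P ** Q) A"
  by (simp add: conj_by_def adj_mult matrix_mul_assoc)

lemma conj_by_mat_1_left [simp]: "conj_by (mat 1) A = A"
  by (simp add: conj_by_def adj_mat_1)

lemma conj_by_mat_1: "P \<in> SU2 \<Longrightarrow> conj_by P (mat 1) = mat 1"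
  by (simp add: conj_by_def SU2_adj_right)

lemma conj_by_adj_left [simp]: "P \<in> SU2 \<Longrightarrow> conj_by (adj P) (conj_by P A) = A"
  by (simp add: conj_by_conj_by SU2_adj_left)

lemma conj_by_adj_right [simp]: "P \<in> SU2 \<Longrightarrow> conj_by P (conj_by (adj P) A) = A"
  by (simp add: conj_by_conj_by SU2_adj_right)

lemma conj_by_SU2: "P \<in> SU2 \<Longrightarrow> A \<in> SU2 \<Longrightarrow> conj_by P A \<in> SU2"
  by (simp add: conj_by_def SU2_mult SU2_adj)

lemma conj_by_su2:
  assumes "P \<in> SU2" "X \<in> su2" shows "conj_by P X \<in> su2"
proof -
  have "trace (conj_by P X) = trace (adj P ** P ** X)"
    unfolding conj_by_def by (subst trace_mul_sym) (simp add: matrix_mul_assoc)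
  then show ?thesis using assms
    by (simp add: su2_def SU2_adj_left conj_by_def adj_mult matrix_mul_assoc
        matrix_minus_left matrix_minus_right)
qed

section \<open>Smoothness and differentials of linear maps; isometry by conjugation\<close>

lemma Ck_on_const: "Ck_on k U (\<lambda>x. c)"
  by (induction k arbitrary: c) simp_all

text \<open>A linear map is its own derivative at every point, so each directional derivative is
  constant in \<open>x\<close> and the constant case finishes all orders.\<close>

lemma Ck_on_linear:
  fixes f :: "'a::euclidean_space \<Rightarrow> 'b::euclidean_space"
  assumes "linear f" shows "Ck_on k U f"
proof (cases k)
  case 0
  then show ?thesis using assms by (simp add: linear_continuous_on linear_linear)
next
  case (Suc n)
  have d: "(f has_derivative f) (at x)" for x
    using assms by (simp add: linear_imp_has_derivative)
  then have "frechet_derivative f (at x) = f" for x using frechet_derivative_at by metis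
  then show ?thesis using d Suc by (auto simp: Ck_on_const differentiable_def)
qed

text \<open>Agreement on \<open>S\<close> is all that can be asked of \<open>g\<close>:
  \<open>inv_into SU2 (conj_by P)\<close> is under control only on \<open>SU2\<close>.\<close>

lemma smooth_map_on_linear:
  assumes "linear f" "\<And>x. x \<in> S \<Longrightarrow> g x = f x" shows "smooth_map_on S g"
  unfolding smooth_map_on_def using assms Ck_on_linear[OF assms(1)]
  by (intro ballI exI[of _ UNIV] exI[of _ f]) auto

lemma SU2_automorphism_conj_by:
  assumes P: "P \<in> SU2" shows "SU2_automorphism (conj_by P)"
proof -
  have bij: "bij_betw (conj_by P) SU2 SU2"
    using P by (intro bij_betw_byWitness[where f' = "conj_by (adj P)"])
      (auto intro: conj_by_SU2 SU2_adj)
  have "inv_into SU2 (conj_by P) y = conj_by (adj P) y" if "y \<in> SU2" for y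
    using that P bij
    by (intro inv_into_f_eq) (auto simp: bij_betw_def intro: conj_by_SU2 SU2_adj)
  then show ?thesis unfolding SU2_automorphism_def
    using bij conj_by_mult[OF P] smooth_map_on_linear linear_conj_by by blast
qed

text \<open>\<open>frechet_derivative\<close> within \<open>S\<close> is a choice among possibly
  many derivatives. By the chain rule along a curve in \<open>S\<close> with velocity
  \<open>X\<close>, all of them agree at \<open>X\<close>, and \<open>f\<close> is one of
  them.\<close>

lemma frechet_derivative_tangent_space:
  assumes lin: "linear f" and X: "X \<in> tangent_space S g"
  shows "frechet_derivative f (at g within S) X = f X"
proof -
  obtain \<gamma> where \<gamma>: "\<And>t. \<gamma> t \<in> S" "\<gamma> 0 = g" and d: "(\<gamma> has_vector_derivative X) (at (0::real))"
    using X unfolding tangent_space_def by blast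
  have D: "(f has_derivative f) (at g within S)"
    using lin by (simp add: linear_imp_has_derivative)
  then have D': "(f has_derivative frechet_derivative f (at g within S)) (at g within S)"
    using frechet_derivative_works differentiable_def by blast
  have sub: "range \<gamma> \<subseteq> S" using \<gamma> by auto
  have "(f \<circ> \<gamma> has_vector_derivative F X) (at 0)"
    if "(f has_derivative F) (at g within S)" for F
    using vector_derivative_diff_chain_within[OF d] has_derivative_subset[OF that sub] \<gamma>(2) by blast
  from vector_derivative_unique_at[OF this[OF D'] this[OF D]] show ?thesis .
qed

text \<open>Conjugation is a homomorphism, hence compatible with left translation, and it is its own
  differential. The isometry at every point therefore reduces to the relation between the forms on
  the Lie algebra.\<close>

lemma isometric_conj_by:
  assumes P: "P \<in> SU2" and q: "\<And>A B. q A B = q' (conj_by P A) (conj_by P B)"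
  shows "isometric_via_automorphism (left_invariant_metric q) (left_invariant_metric q')"
proof -
  have inv: "matrix_inv (conj_by P g) = conj_by P (matrix_inv g)" if "g \<in> SU2" for g
    using that P
    by (intro matrix_inv_eqI)
      (simp add: conj_by_mult[symmetric] SU2_matrix_inv SU2_adj_right conj_by_mat_1)
  have "left_invariant_metric q g X Y = pullback_metric (conj_by P) (left_invariant_metric q') g X Y"
    if "g \<in> SU2" "X \<in> tangent_space SU2 g" "Y \<in> tangent_space SU2 g" for g X Y
    using that P
    by (simp add: left_invariant_metric_def pullback_metric_def linear_conj_by inv q
        frechet_derivative_tangent_space conj_by_mult)
  then show ?thesis unfolding isometric_via_automorphism_def
    using SU2_automorphism_conj_by[OF P] by blast
qed

section \<open>Quaternionic triples\<close>

text \<open>These are the imaginary quaternion units i, j, k. The whole multiplication table is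
  listed so that it can serve as a set of rewrite rules.\<close>

definition quat_triple :: "cmat2 \<Rightarrow> cmat2 \<Rightarrow> cmat2 \<Rightarrow> bool" where
  "quat_triple x y z \<longleftrightarrow> x \<in> su2 \<and> y \<in> su2 \<and> z \<in> su2 \<and>
     x ** x = - mat 1 \<and> y ** y = - mat 1 \<and> z ** z = - mat 1 \<and>
     x ** y = z \<and> y ** z = x \<and> z ** x = y \<and> y ** x = - z \<and> z ** y = - x \<and> x ** z = - y"

lemma quat_triple_rotate: "quat_triple x y z \<Longrightarrow> quat_triple y z x"
  by (simp add: quat_triple_def)

lemma quat_triple_conj_by:
  assumes "P \<in> SU2" "quat_triple x y z"
  shows "quat_triple (conj_by P x) (conj_by P y) (conj_by P z)"
  using assms conj_by_mat_1[OF assms(1)] linear_neg[OF linear_conj_by[of P]]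
  by (simp add: quat_triple_def conj_by_su2 conj_by_mult[symmetric])

lemma su2_entries:
  assumes "X \<in> su2"
  shows "Re (X$1$1) = 0" "X$2$2 = - X$1$1" "X$2$1 = - cnj (X$1$2)"
proof -
  have "adj X = - X" and tr: "X$1$1 + X$2$2 = 0"
    using assms by (simp_all add: su2_def trace_def sum_2)
  then have "cnj (X$1$1) = - X$1$1" "cnj (X$1$2) = - X$2$1"
    by (simp_all add: cmat2_eq_iff)
  then show "Re (X$1$1) = 0" "X$2$1 = - cnj (X$1$2)" by (simp_all add: complex_eq_iff)
  show "X$2$2 = - X$1$1" using tr by (simp add: add_eq_0_iff)
qed

text \<open>This is Cayley-Hamilton for a traceless matrix; the coefficient is the determinant,
  which on \<open>su2\<close> is a sum of squares.\<close>

lemma su2_square: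
  assumes "X \<in> su2"
  shows "X ** X = - (((cmod (X$1$1))\<^sup>2 + (cmod (X$1$2))\<^sup>2) *\<^sub>R mat 1)"
  unfolding cmod_power2 using su2_entries[OF assms]
  by (simp add: cmat2_eq_iff matrix_mult_2 mat_def complex_eq_iff power2_eq_square algebra_simps)

text \<open>Brackets alone determine the associative products here, because squares in
  \<open>su2\<close> are negative scalars: this yields anticommutation, then the products, and
  finally the normalisation of the squares.\<close>

lemma quat_triple_of_brackets:
  assumes su2: "x \<in> su2" "y \<in> su2" "z \<in> su2" and nz: "x \<noteq> 0" "y \<noteq> 0" "z \<noteq> 0"
    and xy: "lie_bracket x y = 2 *\<^sub>R z" and yz: "lie_bracket y z = 2 *\<^sub>R x"
    and zx: "lie_bracket z x = 2 *\<^sub>R y"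
  shows "quat_triple x y z"
proof -
  have sq: "\<exists>n>0. X ** X = - (n *\<^sub>R mat 1)" if "X \<in> su2" "X \<noteq> 0" for X
  proof -
    have "(cmod (X$1$1))\<^sup>2 + (cmod (X$1$2))\<^sup>2 \<noteq> 0"
      using that su2_entries[OF that(1)] by (auto simp: sum_power2_eq_zero_iff cmat2_eq_iff)
    then have "(cmod (X$1$1))\<^sup>2 + (cmod (X$1$2))\<^sup>2 > 0"
      using sum_power2_ge_zero[of "cmod (X$1$1)" "cmod (X$1$2)"] by linarith
    then show ?thesis using su2_square[OF that(1)] by blast
  qed
  obtain a b c where pos: "a > 0" "b > 0" "c > 0"
    and xx: "x ** x = - (a *\<^sub>R mat 1)" and yy: "y ** y = - (b *\<^sub>R mat 1)"
    and zz: "z ** z = - (c *\<^sub>R mat 1)"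
    using sq[of x] sq[of y] sq[of z] su2 nz by blast
  \<comment> \<open>since squares are scalar, \<open>X\<close> anticommutes with every commutator \<open>[X, Y]\<close>\<close>
  have anti: "X ** Z = - (Z ** X)"
    if "X ** Y - Y ** X = 2 *\<^sub>R Z" "X ** X = - (n *\<^sub>R mat 1)" for X Y Z :: cmat2 and n
  proof -
    have "2 *\<^sub>R (X ** Z + Z ** X) = X ** (X ** Y - Y ** X) + (X ** Y - Y ** X) ** X"
      unfolding that(1) by (simp add: matrix_distribs scaleR_add_right)
    also have "\<dots> = X ** X ** Y - Y ** (X ** X)"
      by (simp add: matrix_distribs matrix_mul_assoc)
    also have "\<dots> = 0"
      unfolding that(2) by (simp add: matrix_minus_left matrix_minus_right matrix_distribs)
    finally show ?thesis by (simp add: eq_neg_iff_add_eq_0)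
  qed
  have half: "X ** Y = Z" if "X ** Y - Y ** X = 2 *\<^sub>R Z" "Y ** X = - (X ** Y)" for X Y Z :: cmat2
  proof -
    have "2 *\<^sub>R (X ** Y) = 2 *\<^sub>R Z" using that by (simp add: scaleR_2)
    then show ?thesis by simp
  qed
  note br = xy[unfolded lie_bracket_def] yz[unfolded lie_bracket_def] zx[unfolded lie_bracket_def]
  have xz: "x ** z = - (z ** x)" and yx: "y ** x = - (x ** y)" and zy: "z ** y = - (y ** z)"
    using anti[OF br(1) xx] anti[OF br(2) yy] anti[OF br(3) zz] by auto
  have p: "x ** y = z" "y ** z = x" "z ** x = y"
    using half[OF br(1) yx] half[OF br(2) zy] half[OF br(3) xz] .
  \<comment> \<open>Multiplicativity of the quaternion norm, from expanding the square of
    \<open>X ** Y\<close>.\<close>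
  have norm: "c' = a' * b'"
    if "X ** Y = Z" "Y ** X = - Z" "X ** X = - (a' *\<^sub>R mat 1)" "Y ** Y = - (b' *\<^sub>R mat 1)"
      "Z ** Z = - (c' *\<^sub>R mat 1)" for X Y Z :: cmat2 and a' b' c'
  proof -
    have "Z ** Z = - (X ** Y ** (Y ** X))" using that by (simp add: matrix_minus_right)
    also have "X ** Y ** (Y ** X) = X ** (Y ** Y) ** X" by (simp add: matrix_mul_assoc)
    also have "\<dots> = (a' * b') *\<^sub>R mat 1"
      unfolding that(4) by (simp add: matrix_minus_left matrix_minus_right matrix_distribs that(3))
    finally show ?thesis using that(5) by (simp add: cmat2_eq_iff mat_def)
  qed
  have c: "c = a * b" using norm[OF p(1) _ xx yy zz] yx p(1) by simp
  have a: "a = b * c" using norm[OF p(2) _ yy zz xx] zy p(2) by simp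
  have b: "b = c * a" using norm[OF p(3) _ zz xx yy] xz p(3) by simp
  \<comment> \<open>Substituting one relation into the other gives \<open>m = n * n * m\<close>;
    positivity cancels \<open>m\<close> and excludes \<open>n = -1\<close>.\<close>
  have unit: "n = 1" if "m = n * k" "k = m * n" "m > 0" "n > 0" for m n k :: real
  proof -
    have "m * (n * n) = m" using that(1) unfolding that(2) by (metis mult.left_commute)
    then have "n * n = 1" using that(3) by simp
    then show ?thesis using that(4) by (simp add: power2_eq_1_iff flip: power2_eq_square)
  qed
  have a': "a = c * b" and b': "b = a * c" and c': "c = b * a"
    by (subst a b c, rule mult.commute)+
  have "a = 1" "b = 1" "c = 1"
    using unit[OF b' c' pos(2,1)] unit[OF a c pos(1,2)] unit[OF a' b' pos(1,3)] .
  then show ?thesis unfolding quat_triple_def using su2 xx yy zz p xz yx zy by simp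
qed

text \<open>Conjugation by a unit quaternion turns the plane orthogonal to its axis by twice its
  angle, whence the half angles in \<open>R\<close>. Indeed \<open>y\<close> and \<open>z\<close>
  anticommute with \<open>x\<close>, so \<open>R\<close> acts on them as left multiplication by its
  square.\<close>

lemma quat_triple_rotation:
  fixes t :: real
  assumes q: "quat_triple x y z"
  obtains R where "R \<in> SU2" "conj_by R x = x"
    "conj_by R y = cos t *\<^sub>R y - sin t *\<^sub>R z" "conj_by R z = sin t *\<^sub>R y + cos t *\<^sub>R z"
proof -
  define c s where "c = cos (t/2)" and "s = sin (t/2)"
  have cs: "c * c + s * s = 1" "cos t = c * c - s * s" "sin t = c * s + c * s"
    using sin_double[of "t/2"] cos_double[of "t/2"] sin_cos_squared_add[of "t/2"]
    by (simp_all add: c_def s_def power2_eq_square)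
  define R where "R = c *\<^sub>R mat 1 - s *\<^sub>R x"
  have x: "x ** x = - mat 1" "x ** y = z" "y ** x = - z" "x ** z = - y" "z ** x = y"
    "adj x = - x" "x \<in> su2" using q by (auto simp: quat_triple_def su2_def)
  have aR: "adj R = c *\<^sub>R mat 1 + s *\<^sub>R x"
    using x(6) adj_add[of "c *\<^sub>R mat 1" "- (s *\<^sub>R x)"] adj_scaleR[of "- s" x]
    by (simp add: R_def adj_scaleR adj_mat_1)
  have "adj R ** R = (c * c + s * s) *\<^sub>R mat 1"
    unfolding aR unfolding R_def by (simp add: matrix_distribs x algebra_simps)
  then have one: "adj R ** R = mat 1" by (simp add: cs)
  \<comment> \<open>This entry says that the traceless matrix \<open>x\<close> has determinant 1;
    then det \<open>R\<close> is \<open>c * c + s * s\<close>.\<close>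
  have "(x ** x) $ 1 $ 1 = - 1" using x by (simp add: mat_def)
  then have "x$1$1 * x$1$1 + x$1$2 * x$2$1 = - 1" by (simp only: matrix_mult_2)
  moreover have "det R = of_real (c * c) - of_real (s * s) * (x$1$1 * x$1$1 + x$1$2 * x$2$1)"
  proof -
    have entry: "R $ i $ j = of_real c * (mat 1 :: cmat2) $ i $ j - of_real s * x $ i $ j" for i j
      by (simp add: R_def scaleR_conv_of_real[where 'a = complex])
    show ?thesis
      unfolding det_2 entry su2_entries(2)[OF x(7)] by (simp add: mat_def algebra_simps)
  qed
  ultimately have "det R = of_real (c * c + s * s)" by simp
  then have R: "R \<in> SU2" using one cs by (simp add: SU2_def)
  show thesis
  proof
    show "R \<in> SU2" by fact
    have "R ** x = x ** R" by (simp add: R_def matrix_distribs)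
    then have "conj_by R x = x ** (R ** adj R)" by (simp add: conj_by_def matrix_mul_assoc)
    then show "conj_by R x = x" by (simp add: SU2_adj_right R)
    have Ry: "R ** y = c *\<^sub>R y - s *\<^sub>R z" and Rz: "R ** z = c *\<^sub>R z + s *\<^sub>R y"
      by (simp_all add: R_def matrix_distribs x)
    \<comment> \<open>The product \<open>2 * v\<close> is componentwise, so it is
      \<open>v + v\<close>; the rule reconciles doubled scalars with doubled matrices.\<close>
    have two: "(2 * k) *\<^sub>R v = k *\<^sub>R (2 * v)" for k and v :: cmat2
      unfolding mult_2 scaleR_add_left scaleR_add_right ..
    show "conj_by R y = cos t *\<^sub>R y - sin t *\<^sub>R z" "conj_by R z = sin t *\<^sub>R y + cos t *\<^sub>R z"
      unfolding cs(2,3) conj_by_def aR Ry Rz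
      by (simp_all add: matrix_distribs x scaleR_add_left scaleR_diff_left scaleR_add_right
          scaleR_diff_right mult.commute[of s c] diff_diff_eq diff_add_eq add_diff_eq
          add.assoc add.commute add.left_commute two)
  qed
qed

section \<open>Diagonalisation\<close>

lemma symmetric_bilinear_on_expand:
  assumes q: "symmetric_bilinear_on V q" and V: "subspace V" and xyz: "x \<in> V" "y \<in> V" "z \<in> V"
  shows "q (a *\<^sub>R x + b *\<^sub>R y + c *\<^sub>R z) (a *\<^sub>R x + b *\<^sub>R y + c *\<^sub>R z) =
    a\<^sup>2 * q x x + b\<^sup>2 * q y y + c\<^sup>2 * q z z
    + 2 * (a * b) * q x y + 2 * (a * c) * q x z + 2 * (b * c) * q y z"
proof -
  have sym: "q u v = q v u" and add: "q (u + w) v = q u v + q w v"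
    and sc: "q (k *\<^sub>R u) v = k * q u v" if "u \<in> V" "v \<in> V" "w \<in> V" for u v w k
    using q that by (auto simp: symmetric_bilinear_on_def)
  define u where "u = a *\<^sub>R x + b *\<^sub>R y + c *\<^sub>R z"
  have uV: "u \<in> V" and mem: "a *\<^sub>R x \<in> V" "b *\<^sub>R y \<in> V" "c *\<^sub>R z \<in> V" "a *\<^sub>R x + b *\<^sub>R y \<in> V"
    using V xyz by (auto simp: u_def subspace_add subspace_scale)
  have left: "q u v = a * q x v + b * q y v + c * q z v" if "v \<in> V" for v
    unfolding u_def using add sc mem xyz that by simp
  \<comment> \<open>Linearity is available in the first argument only; symmetry carries it to the
    second.\<close>
  have "q u u = a * q u x + b * q u y + c * q u z"
    using left[OF uV] sym[OF uV xyz(1) uV] sym[OF uV xyz(2) uV] sym[OF uV xyz(3) uV] by simp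
  also have "\<dots> = a\<^sup>2 * q x x + b\<^sup>2 * q y y + c\<^sup>2 * q z z
      + 2 * (a * b) * q x y + 2 * (a * c) * q x z + 2 * (b * c) * q y z"
    using left xyz sym[of y x x] sym[of z x x] sym[of z y x]
    by (simp add: algebra_simps power2_eq_square)
  finally show ?thesis by (simp add: u_def)
qed

text \<open>The expression vanishes at 0, which is therefore a minimum, and its derivative there is
  \<open>2 * b\<close>. The value at \<open>pi/2\<close> is \<open>e\<close>.\<close>

lemma trig_form_nonneg:
  fixes b e :: real
  assumes "\<And>t. (sin t)\<^sup>2 * e + 2 * (sin t * cos t) * b \<ge> 0"
  shows "b = 0 \<and> e \<ge> 0"
proof -
  let ?g = "\<lambda>t::real. (sin t)\<^sup>2 * e + 2 * (sin t * cos t) * b"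
  have "(?g has_real_derivative 2 * b) (at 0)"
    by (auto intro!: derivative_eq_intros)
  then have "2 * b = 0"
    by (rule DERIV_local_min[where d = 1]) (use assms in auto)
  then show ?thesis using assms[of "pi/2"] by simp
qed

section \<open>Coordinates in \<open>su2\<close> and continuity of the form along
  conjugation\<close>

lemma subspace_su2: "subspace su2"
proof (rule subspaceI)
  show "0 \<in> su2" by (simp add: su2_def vec_eq_iff trace_def)
  show "X + Y \<in> su2" if "X \<in> su2" "Y \<in> su2" for X Y
    using that by (simp add: su2_def adj_add trace_add)
  show "c *\<^sub>R X \<in> su2" if "X \<in> su2" for c X
    using that by (simp add: su2_def adj_scaleR trace_def scaleR_sum_right[symmetric])
qed

lemma span_insert3:
  fixes x :: "'a::real_vector"
  assumes "X \<in> span {x, y, z}"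
  obtains a b c where "X = a *\<^sub>R x + b *\<^sub>R y + c *\<^sub>R z"
proof -
  obtain a b c where "X - a *\<^sub>R x - b *\<^sub>R y - c *\<^sub>R z = 0"
    using assms unfolding span_breakdown_eq span_empty singleton_iff by blast
  then show thesis using that[of a b c] by (simp add: algebra_simps)
qed

text \<open>The products of distinct units lie in \<open>su2\<close>, so their first diagonal entry
  is imaginary, while the squares are -1. Taking -Re of that entry thus reads off coordinates by a
  formula continuous in \<open>X\<close>.\<close>

lemma quat_triple_coords:
  assumes q: "quat_triple x y z" and X: "X \<in> su2" and sp: "su2 = span {x, y, z}"
  shows "X = (- Re ((X ** x)$1$1)) *\<^sub>R x + (- Re ((X ** y)$1$1)) *\<^sub>R y + (- Re ((X ** z)$1$1)) *\<^sub>R z"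
proof -
  obtain a b c where X: "X = a *\<^sub>R x + b *\<^sub>R y + c *\<^sub>R z"
    using X sp span_insert3 by blast
  have Re0: "Re (x$1$1) = 0" "Re (y$1$1) = 0" "Re (z$1$1) = 0"
    using q su2_entries(1) by (auto simp: quat_triple_def)
  have "Re ((X ** x)$1$1) = - a" "Re ((X ** y)$1$1) = - b" "Re ((X ** z)$1$1) = - c"
    using q Re0 unfolding X quat_triple_def by (simp_all add: matrix_distribs mat_def)
  then show ?thesis using X by simp
qed

text \<open>Nothing is known about \<open>q\<close> as a function on all matrices; continuity comes
  from writing its value as a quadratic polynomial in the coordinates of
  \<open>conj_by P w\<close>.\<close>

lemma continuous_on_conj_form:
  assumes q: "symmetric_bilinear_on su2 q" and t: "quat_triple x y z"
    and sp: "su2 = span {x, y, z}" and w: "w \<in> su2"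
  shows "continuous_on SU2 (\<lambda>P. q (conj_by P w) (conj_by P w))"
proof -
  have xyz: "x \<in> su2" "y \<in> su2" "z \<in> su2" using t by (auto simp: quat_triple_def)
  define f where "f (v :: cmat2) P = - Re ((conj_by P w ** v)$1$1)" for v P
  have "continuous_on SU2 (f v)" for v
    unfolding f_def conj_by_def matrix_mult_2 adj_nth by (intro continuous_intros)
  then have "continuous_on SU2 (\<lambda>P. (f x P)\<^sup>2 * q x x + (f y P)\<^sup>2 * q y y + (f z P)\<^sup>2 * q z z
    + 2 * (f x P * f y P) * q x y + 2 * (f x P * f z P) * q x z + 2 * (f y P * f z P) * q y z)"
    by (intro continuous_intros)
  moreover have "q (conj_by P w) (conj_by P w) =
      (f x P)\<^sup>2 * q x x + (f y P)\<^sup>2 * q y y + (f z P)\<^sup>2 * q z z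
    + 2 * (f x P * f y P) * q x y + 2 * (f x P * f z P) * q x z + 2 * (f y P * f z P) * q y z"
    if "P \<in> SU2" for P
  proof -
    have "conj_by P w = f x P *\<^sub>R x + f y P *\<^sub>R y + f z P *\<^sub>R z"
      unfolding f_def using quat_triple_coords[OF t conj_by_su2[OF that w] sp] .
    then show ?thesis using symmetric_bilinear_on_expand[OF q subspace_su2 xyz] by simp
  qed
  ultimately show ?thesis by (simp cong: continuous_on_cong)
qed

text \<open>Rotating about \<open>x\<close> keeps the first term and mixes the other two; the change
  is the form of \<open>trig_form_nonneg\<close>, scaled by the weight difference \<open>k\<close>.
  Arbitrary weights let one lemma serve all three axes.\<close>

lemma quat_triple_critical:
  assumes q: "symmetric_bilinear_on su2 q" and t: "quat_triple x y z" and k: "k \<noteq> 0"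
    and min: "\<And>R. R \<in> SU2 \<Longrightarrow> l * q x x + m * q y y + (m + k) * q z z \<le>
      l * q (conj_by R x) (conj_by R x) + m * q (conj_by R y) (conj_by R y)
        + (m + k) * q (conj_by R z) (conj_by R z)"
  shows "q y z = 0 \<and> k * (q y y - q z z) \<ge> 0"
proof -
  have xyz: "x \<in> su2" "y \<in> su2" "z \<in> su2" using t by (auto simp: quat_triple_def)
  note ex = symmetric_bilinear_on_expand[OF q subspace_su2 xyz, of 0]
  have "(sin \<theta>)\<^sup>2 * (k * (q y y - q z z)) + 2 * (sin \<theta> * cos \<theta>) * (k * q y z) \<ge> 0" for \<theta>
  proof -
    obtain R where R: "R \<in> SU2" "conj_by R x = x"
      "conj_by R y = cos \<theta> *\<^sub>R y - sin \<theta> *\<^sub>R z" "conj_by R z = sin \<theta> *\<^sub>R y + cos \<theta> *\<^sub>R z"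
      using quat_triple_rotation[OF t] by blast
    have "m * q y y + (m + k) * q z z \<le>
      m * ((cos \<theta>)\<^sup>2 * q y y + (sin \<theta>)\<^sup>2 * q z z - 2 * (cos \<theta> * sin \<theta>) * q y z) +
      (m + k) * ((sin \<theta>)\<^sup>2 * q y y + (cos \<theta>)\<^sup>2 * q z z + 2 * (sin \<theta> * cos \<theta>) * q y z)"
      using min[OF R(1)] ex[of "cos \<theta>" "- sin \<theta>"] ex[of "sin \<theta>" "cos \<theta>"] by (simp add: R)
    also have "\<dots> = m * q y y + (m + k) * q z z
        + ((sin \<theta>)\<^sup>2 * (k * (q y y - q z z)) + 2 * (sin \<theta> * cos \<theta>) * (k * q y z))"
      unfolding cos_squared_eq by (simp add: algebra_simps)
    finally show ?thesis by simp
  qed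
  from trig_form_nonneg[OF this] show ?thesis using k by simp
qed

lemma exists_diagonalising_conjugation:
  assumes q: "symmetric_bilinear_on su2 q" and t: "quat_triple x y z" and sp: "su2 = span {x, y, z}"
  obtains P where "P \<in> SU2"
    "q (conj_by P x) (conj_by P y) = 0" "q (conj_by P y) (conj_by P z) = 0"
    "q (conj_by P z) (conj_by P x) = 0"
    "q (conj_by P x) (conj_by P x) \<ge> q (conj_by P y) (conj_by P y)"
    "q (conj_by P y) (conj_by P y) \<ge> q (conj_by P z) (conj_by P z)"
proof -
  \<comment> \<open>The weights of the three diagonal values are -1, 0, 1. Being distinct, they give
    a nonzero \<open>k\<close> for each pair.\<close>
  define F where "F P = q (conj_by P z) (conj_by P z) - q (conj_by P x) (conj_by P x)" for P
  have "continuous_on SU2 F" unfolding F_def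
    using continuous_on_conj_form[OF q t sp] t
    by (intro continuous_on_diff) (auto simp: quat_triple_def)
  moreover have "mat 1 \<in> SU2" by (simp add: SU2_def adj_mat_1)
  ultimately obtain P where P: "P \<in> SU2" and min: "\<And>Q. Q \<in> SU2 \<Longrightarrow> F P \<le> F Q"
    using continuous_attains_inf[OF compact_SU2] by blast
  let ?x = "conj_by P x" and ?y = "conj_by P y" and ?z = "conj_by P z"
  have t': "quat_triple ?x ?y ?z" using quat_triple_conj_by[OF P t] .
  have min': "q ?z ?z - q ?x ?x \<le> q (conj_by R ?z) (conj_by R ?z) - q (conj_by R ?x) (conj_by R ?x)"
    if "R \<in> SU2" for R
    using min[OF SU2_mult[OF that P]] by (simp add: F_def conj_by_conj_by)
  \<comment> \<open>The same weights are read in the cyclic orders (-1, 0, 1), (0, 1, -1) and (1,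
    -1, 0), so \<open>k\<close> is 1, -2 and 1.\<close>
  have 1: "q ?y ?z = 0 \<and> 1 * (q ?y ?y - q ?z ?z) \<ge> 0"
    by (rule quat_triple_critical[OF q t', of 1 "-1" 0]) (use min' in auto)
  have 2: "q ?z ?x = 0 \<and> - 2 * (q ?z ?z - q ?x ?x) \<ge> 0"
    by (rule quat_triple_critical[OF q quat_triple_rotate[OF t'], of "-2" 0 1]) (use min' in auto)
  have 3: "q ?x ?y = 0 \<and> 1 * (q ?x ?x - q ?y ?y) \<ge> 0"
    by (rule quat_triple_critical[OF q quat_triple_rotate[OF quat_triple_rotate[OF t']], of 1 1 "-1"])
      (use min' in auto)
  show thesis by (rule that) (use 1 2 3 P in auto)
qed

text \<open>An instance of Sylvester's law. If \<open>q z z\<close> were nonnegative, so would be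
  the whole form, against \<open>e3\<close>; if \<open>q y y\<close> were not positive, the form
  would be nonpositive on the plane of \<open>y\<close> and \<open>z\<close>, against the positive
  plane of \<open>e1\<close> and \<open>e2\<close>.\<close>

lemma signature_of_ordered_diagonal:
  assumes q: "symmetric_bilinear_on V q" and V: "V = span {x, y, z}"
    and diag: "q x y = 0" "q y z = 0" "q z x = 0"
    and ord: "q x x \<ge> q y y" "q y y \<ge> q z z" and sig: "signature_ppm_on V q"
  shows "q y y > 0 \<and> q z z < 0"
proof -
  have sub: "subspace V" using V by simp
  have xyz: "x \<in> V" "y \<in> V" "z \<in> V" unfolding V by (auto intro: span_base)
  then have "q x z = 0" using q diag by (simp add: symmetric_bilinear_on_def)
  then have form: "q (a *\<^sub>R x + b *\<^sub>R y + c *\<^sub>R z) (a *\<^sub>R x + b *\<^sub>R y + c *\<^sub>R z) =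
      a\<^sup>2 * q x x + b\<^sup>2 * q y y + c\<^sup>2 * q z z" for a b c
    using symmetric_bilinear_on_expand[OF q sub xyz] diag by simp
  obtain e1 e2 e3 where e: "ordered_basis V [e1, e2, e3]" "q e1 e2 = 0"
      "q e1 e1 > 0" "q e2 e2 > 0" "q e3 e3 < 0"
    using sig unfolding signature_ppm_on_def by blast
  have eV: "e1 \<in> V" "e2 \<in> V" "e3 \<in> V" using e(1) by (auto simp: ordered_basis_def intro: span_base)
  have neg: "q z z < 0"
  proof (rule ccontr)
    assume "\<not> q z z < 0"
    moreover obtain a b c where "e3 = a *\<^sub>R x + b *\<^sub>R y + c *\<^sub>R z"
      using eV V span_insert3 by blast
    ultimately have "q e3 e3 \<ge> 0" using form[of a b c] ord by simp
    then show False using e by simp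
  qed
  have "q y y > 0"
  proof (rule ccontr)
    assume np: "\<not> q y y > 0"
    obtain a1 b1 c1 where e1: "e1 = a1 *\<^sub>R x + b1 *\<^sub>R y + c1 *\<^sub>R z"
      using eV V span_insert3 by blast
    obtain a2 b2 c2 where e2: "e2 = a2 *\<^sub>R x + b2 *\<^sub>R y + c2 *\<^sub>R z"
      using eV V span_insert3 by blast
    have le: "q (b *\<^sub>R y + c *\<^sub>R z) (b *\<^sub>R y + c *\<^sub>R z) \<le> 0" for b c
      using form[of 0 b c] np neg by (simp add: add_nonpos_nonpos mult_nonneg_nonpos)
    \<comment> \<open>a vector of the positive plane spanned by \<open>e1\<close>, \<open>e2\<close> inside the span of \<open>y\<close>, \<open>z\<close>\<close>
    have "a2 *\<^sub>R e1 + (- a1) *\<^sub>R e2 = (a2 * b1 - a1 * b2) *\<^sub>R y + (a2 * c1 - a1 * c2) *\<^sub>R z"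
      unfolding e1 e2 by (simp add: algebra_simps)
    then have "q (a2 *\<^sub>R e1 + (- a1) *\<^sub>R e2) (a2 *\<^sub>R e1 + (- a1) *\<^sub>R e2) \<le> 0" using le by simp
    moreover have "q (a2 *\<^sub>R e1 + (- a1) *\<^sub>R e2) (a2 *\<^sub>R e1 + (- a1) *\<^sub>R e2) =
        a2\<^sup>2 * q e1 e1 + a1\<^sup>2 * q e2 e2"
      using symmetric_bilinear_on_expand[OF q sub eV, of a2 "- a1" 0] e(2) by simp
    ultimately have sum: "a2\<^sup>2 * q e1 e1 + a1\<^sup>2 * q e2 e2 \<le> 0" by simp
    \<comment> \<open>Once \<open>a1\<close> vanishes, \<open>e1\<close> itself lies in the span of
      \<open>y\<close> and \<open>z\<close>, where the form is nonpositive.\<close>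
    have "a1 = 0"
    proof (rule ccontr)
      assume "a1 \<noteq> 0"
      then have "a1\<^sup>2 * q e2 e2 > 0" using e by simp
      moreover have "a2\<^sup>2 * q e1 e1 \<ge> 0" using e by simp
      ultimately show False using sum by linarith
    qed
    then have "q e1 e1 \<le> 0" using le[of b1 c1] e1 by simp
    then show False using e by simp
  qed
  then show ?thesis using neg by simp
qed

section \<open>Pulling back forms, and assembly of the result\<close>

lemma symmetric_bilinear_on_pullback:
  assumes "linear f" "\<And>v. v \<in> V \<Longrightarrow> f v \<in> V" "symmetric_bilinear_on V q"
  shows "symmetric_bilinear_on V (\<lambda>u v. q (f u) (f v))"
  using assms by (simp add: symmetric_bilinear_on_def linear_add linear_scale)

lemma nondegenerate_on_pullback:
  assumes "linear f" "bij_betw f V V" "0 \<in> V" "nondegenerate_on V q"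
  shows "nondegenerate_on V (\<lambda>u v. q (f u) (f v))"
  unfolding nondegenerate_on_def
proof (intro ballI impI)
  fix u assume u: "u \<in> V" and "\<forall>v\<in>V. q (f u) (f v) = 0"
  then have "\<forall>v\<in>V. q (f u) v = 0" using assms(2) by (metis bij_betw_iff_bijections)
  then have "f u = f 0" using assms u bij_betwE linear_0 unfolding nondegenerate_on_def by metis
  then show "u = 0" using assms u by (meson bij_betw_def inj_onD)
qed

theorem theorem3p2:
  fixes \<sigma>x \<sigma>y \<sigma>z :: cmat2
    and q :: "cmat2 \<Rightarrow> cmat2 \<Rightarrow> real"
  assumes basis: "ordered_basis su2 [\<sigma>x, \<sigma>y, \<sigma>z]"
    and xy: "lie_bracket \<sigma>x \<sigma>y = 2 *\<^sub>R \<sigma>z"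
    and yz: "lie_bracket \<sigma>y \<sigma>z = 2 *\<^sub>R \<sigma>x"
    and zx: "lie_bracket \<sigma>z \<sigma>x = 2 *\<^sub>R \<sigma>y"
    and lorentzian: "lorentzian_form_on su2 q"
  shows "\<exists>q' \<mu>\<^sub>1 \<mu>\<^sub>2 \<mu>\<^sub>3.
           lorentzian_form_on su2 q' \<and>
           isometric_via_automorphism (left_invariant_metric q) (left_invariant_metric q') \<and>
           gram_matrix q' (vector [\<sigma>x, \<sigma>y, \<sigma>z] :: cmat2 ^ 3) =
             vector [vector [\<mu>\<^sub>1, 0, 0],
                     vector [0, \<mu>\<^sub>2, 0],
                     vector [0, 0, - \<mu>\<^sub>3]] \<and>
           \<mu>\<^sub>1 \<ge> \<mu>\<^sub>2 \<and> \<mu>\<^sub>2 > 0 \<and> \<mu>\<^sub>3 > 0"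
proof -
  have span: "su2 = span {\<sigma>x, \<sigma>y, \<sigma>z}" and ind: "independent {\<sigma>x, \<sigma>y, \<sigma>z}"
    using basis by (auto simp: ordered_basis_def)
  have "\<sigma>x \<in> su2" "\<sigma>y \<in> su2" "\<sigma>z \<in> su2" unfolding span by (auto intro: span_base)
  moreover have "0 \<notin> {\<sigma>x, \<sigma>y, \<sigma>z}" using ind dependent_zero[of "{\<sigma>x, \<sigma>y, \<sigma>z}"] by argo
  then have "\<sigma>x \<noteq> 0" "\<sigma>y \<noteq> 0" "\<sigma>z \<noteq> 0" by auto
  ultimately have \<sigma>: "quat_triple \<sigma>x \<sigma>y \<sigma>z" using quat_triple_of_brackets xy yz zx by blast
  have q: "symmetric_bilinear_on su2 q" "nondegenerate_on su2 q" "signature_ppm_on su2 q"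
    using lorentzian by (auto simp: lorentzian_form_on_def)
  obtain P where P: "P \<in> SU2"
    and diag: "q (conj_by P \<sigma>x) (conj_by P \<sigma>y) = 0" "q (conj_by P \<sigma>y) (conj_by P \<sigma>z) = 0"
      "q (conj_by P \<sigma>z) (conj_by P \<sigma>x) = 0"
    and ord: "q (conj_by P \<sigma>x) (conj_by P \<sigma>x) \<ge> q (conj_by P \<sigma>y) (conj_by P \<sigma>y)"
      "q (conj_by P \<sigma>y) (conj_by P \<sigma>y) \<ge> q (conj_by P \<sigma>z) (conj_by P \<sigma>z)"
    using exists_diagonalising_conjugation[OF q(1) \<sigma> span] by blast
  have bij: "bij_betw (conj_by P) su2 su2"
    using P by (intro bij_betw_byWitness[where f' = "conj_by (adj P)"])
      (auto intro: conj_by_su2 SU2_adj)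
  have "su2 = conj_by P ` span {\<sigma>x, \<sigma>y, \<sigma>z}" using bij span by (simp add: bij_betw_def)
  then have "su2 = span {conj_by P \<sigma>x, conj_by P \<sigma>y, conj_by P \<sigma>z}"
    by (simp add: linear_span_image[OF linear_conj_by, symmetric])
  then have sgn: "q (conj_by P \<sigma>y) (conj_by P \<sigma>y) > 0" "q (conj_by P \<sigma>z) (conj_by P \<sigma>z) < 0"
    using signature_of_ordered_diagonal[OF q(1) _ diag ord q(3)] by auto
  \<comment> \<open>Moving the form instead of the basis: the Gram matrix of \<open>q'\<close> in
    the given basis is that of \<open>q\<close> in the conjugated one.\<close>
  define q' where "q' A B = q (conj_by P A) (conj_by P B)" for A B
  have q'_eq: "q' = (\<lambda>A B. q (conj_by P A) (conj_by P B))" by (simp add: q'_def fun_eq_iff)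
  have sym: "symmetric_bilinear_on su2 q'" and nondeg: "nondegenerate_on su2 q'"
    unfolding q'_eq using q P bij
    by (simp_all add: symmetric_bilinear_on_pullback nondegenerate_on_pullback linear_conj_by
        conj_by_su2 subspace_0 subspace_su2)
  have off: "q' \<sigma>x \<sigma>y = 0" "q' \<sigma>y \<sigma>z = 0" "q' \<sigma>z \<sigma>x = 0" using diag by (simp_all add: q'_def)
  have off': "q' \<sigma>y \<sigma>x = 0" "q' \<sigma>z \<sigma>y = 0" "q' \<sigma>x \<sigma>z = 0"
    using off sym \<sigma> by (simp_all add: symmetric_bilinear_on_def quat_triple_def)
  have pos: "q' \<sigma>x \<sigma>x \<ge> q' \<sigma>y \<sigma>y" "q' \<sigma>y \<sigma>y > 0" "q' \<sigma>z \<sigma>z < 0"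
    using sgn ord by (simp_all add: q'_def)
  have "signature_ppm_on su2 q'"
    unfolding signature_ppm_on_def using basis off off' pos
    by (intro exI[of _ \<sigma>x] exI[of _ \<sigma>y] exI[of _ \<sigma>z]) auto
  then have "lorentzian_form_on su2 q'" using sym nondeg by (simp add: lorentzian_form_on_def)
  moreover have "isometric_via_automorphism (left_invariant_metric q) (left_invariant_metric q')"
    \<comment> \<open>The inverse conjugation appears because \<open>q\<close> has to be expressed
      through \<open>q'\<close>.\<close>
    using P by (intro isometric_conj_by[of "adj P"]) (auto simp: SU2_adj q'_def)
  moreover have "gram_matrix q' (vector [\<sigma>x, \<sigma>y, \<sigma>z] :: cmat2 ^ 3) =
      vector [vector [q' \<sigma>x \<sigma>x, 0, 0], vector [0, q' \<sigma>y \<sigma>y, 0], vector [0, 0, - (- q' \<sigma>z \<sigma>z)]]"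
    by (simp add: vec_eq_iff forall_3 gram_matrix_def vector_3 off off')
  ultimately show ?thesis using pos
    by (intro exI[of _ q'] exI[of _ "q' \<sigma>x \<sigma>x"] exI[of _ "q' \<sigma>y \<sigma>y"] exI[of _ "- q' \<sigma>z \<sigma>z"]) simp
qed

end
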